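(* Let $f\colon \mathbb{R}_+\times X\to X$ be a $C^0$-semi flow on a Polish space $X$ and let $f(t,p)$, $p\in X$, be a Lagrange stable motion in $X$. If $\mathcal{C}_p$ is generic and $\mathcal{C}_p$ itself is not a minimal subset of $(X,f)$, then there exists a residual subset $S$ of $\mathcal{C}_p$ such that the motion $f(t,x)$ is chaotic for $f$ for each $x\in S$.
   Context: $\mathbb{R}_+=[0,\infty)$, and $X$ is equipped with a complete separable metric $d$. A $C^0$-semi flow on $X$ is a map $f\colon\mathbb{R}_+\times X\to X$ such that $f(0,x)=x$ for all $x$; $f$ is jointly continuous; and $f(t_2,f(t_1,x))=f(t_1+t_2,x)$ for all $x\in X$, $t_1,t_2\in\mathbb{R}_+$. The motion $f(t,x)$ is Lagrange stable if the closure of the orbit $\mathcal{O}_f(x)=f(\mathbb{R}_+,x)$ is compact. A closed set $C\subseteq X$ is a center of attraction of the motion $f(t,x)$ if $\lim_{T\to+\infty}\frac1T\int_0^T\mathds{1}_{B_\varepsilon(C)}(f(t,x))\,dt=1$ for every $\varepsilon>0$, where $B_\varepsilon(C)$ is the $\varepsilon$-neighborhood of $C$ in $X$. The minimal center of attraction $\mathcal{C}_x$ of $f(t,x)$ is a center of attraction having no proper subset that is also a center of attraction of $f(t,x)$; it exists for every Lagrange stable motion. A set $\Lambda\subseteq X$ is ($f$-)invariant if $f(t,x)\in\Lambda$ for all $x\in\Lambda$, $t\ge0$. A minimal subset of $(X,f)$ is a nonempty closed invariant set having no proper nonempty closed invariant subset. An $f$-invariant set $\Lambda$ is generic if there exists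 $x\in\Lambda$ with $\Lambda=\mathcal{C}_x$. (Minimal centers of attraction are $f$-invariant.) A motion $f(t,x)$ is chaotic for $f$ if there is some $y\in X$ such that $$\liminf_{t\to+\infty}d(f(t,x),y)=0,\quad\limsup_{t\to+\infty}d(f(t,x),y)>0,$$ $$\liminf_{t\to+\infty}d(f(t,x),f(t,y))=0,\quad\limsup_{t\to+\infty}d(f(t,x),f(t,y))>0.$$ A subset of a space is residual if it contains a dense $G_\delta$ subset of that space. *)

theory Defs
  imports "HOL-Analysis.Analysis"
begin

text \<open>A semi-flow \<open>f :: \<real>\<^sub>+ \<times> X \<rightarrow> X\<close> is rendered as a curried function on all of \<^typ>\<open>real\<close>;
  every notion below only inspects its values at times \<open>t \<ge> 0\<close>.\<close>

definition semiflow :: "(real \<Rightarrow> 'a::metric_space \<Rightarrow> 'a) \<Rightarrow> bool" where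
  "semiflow f \<longleftrightarrow>
     (\<forall>x. f 0 x = x) \<and>
     continuous_on ({0..} \<times> UNIV) (\<lambda>(t, x). f t x) \<and>
     (\<forall>x. \<forall>t1\<ge>0. \<forall>t2\<ge>0. f t2 (f t1 x) = f (t1 + t2) x)"

definition orbit :: "(real \<Rightarrow> 'a \<Rightarrow> 'a) \<Rightarrow> 'a \<Rightarrow> 'a set" where
  "orbit f x = (\<lambda>t. f t x) ` {0..}"

definition lagrange_stable :: "(real \<Rightarrow> 'a::metric_space \<Rightarrow> 'a) \<Rightarrow> 'a \<Rightarrow> bool" where
  "lagrange_stable f x \<longleftrightarrow> compact (closure (orbit f x))"

definition nbhd :: "real \<Rightarrow> 'a::metric_space set \<Rightarrow> 'a set" where
  "nbhd \<epsilon> C = (\<Union>c\<in>C. ball c \<epsilon>)"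

definition center_of_attraction ::
    "(real \<Rightarrow> 'a::metric_space \<Rightarrow> 'a) \<Rightarrow> 'a \<Rightarrow> 'a set \<Rightarrow> bool" where
  "center_of_attraction f x C \<longleftrightarrow>
     closed C \<and>
     (\<forall>\<epsilon>>0. ((\<lambda>T. (1 / T) * (LINT t:{0..T}|lborel. indicator (nbhd \<epsilon> C) (f t x)))
        \<longlongrightarrow> (1::real)) at_top)"

definition is_minimal_center ::
    "(real \<Rightarrow> 'a::metric_space \<Rightarrow> 'a) \<Rightarrow> 'a \<Rightarrow> 'a set \<Rightarrow> bool" where
  "is_minimal_center f x C \<longleftrightarrow>
     center_of_attraction f x C \<and> (\<nexists>D. D \<subset> C \<and> center_of_attraction f x D)"

text \<open>The set \<open>\<C>\<^sub>x\<close>; the description is proper for Lagrange stable motions, see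
  \<open>ex1_minimal_center\<close> below.\<close>

definition minimal_center :: "(real \<Rightarrow> 'a::metric_space \<Rightarrow> 'a) \<Rightarrow> 'a \<Rightarrow> 'a set" where
  "minimal_center f x = (THE C. is_minimal_center f x C)"

definition invariant :: "(real \<Rightarrow> 'a \<Rightarrow> 'a) \<Rightarrow> 'a set \<Rightarrow> bool" where
  "invariant f \<Lambda> \<longleftrightarrow> (\<forall>x\<in>\<Lambda>. \<forall>t\<ge>0. f t x \<in> \<Lambda>)"

definition minimal_subset :: "(real \<Rightarrow> 'a::metric_space \<Rightarrow> 'a) \<Rightarrow> 'a set \<Rightarrow> bool" where
  "minimal_subset f M \<longleftrightarrow>
     M \<noteq> {} \<and> closed M \<and> invariant f M \<and>
     (\<nexists>N. N \<subset> M \<and> N \<noteq> {} \<and> closed N \<and> invariant f N)"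

text \<open>For \<open>x\<close> without a minimal center of attraction the value of \<^const>\<open>minimal_center\<close> is
  meaningless, so \<open>\<Lambda> = \<C>\<^sub>x\<close> is expressed by the defining property of \<open>\<C>\<^sub>x\<close>.\<close>

definition generic :: "(real \<Rightarrow> 'a::metric_space \<Rightarrow> 'a) \<Rightarrow> 'a set \<Rightarrow> bool" where
  "generic f \<Lambda> \<longleftrightarrow> invariant f \<Lambda> \<and> (\<exists>x\<in>\<Lambda>. is_minimal_center f x \<Lambda>)"

text \<open>Limits inferior and superior are taken in the extended reals, where they always exist.\<close>

definition chaotic :: "(real \<Rightarrow> 'a::metric_space \<Rightarrow> 'a) \<Rightarrow> 'a \<Rightarrow> bool" where
  "chaotic f x \<longleftrightarrow> (\<exists>y.
     Liminf at_top (\<lambda>t. ereal (dist (f t x) y)) = 0 \<and>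
     Limsup at_top (\<lambda>t. ereal (dist (f t x) y)) > 0 \<and>
     Liminf at_top (\<lambda>t. ereal (dist (f t x) (f t y))) = 0 \<and>
     Limsup at_top (\<lambda>t. ereal (dist (f t x) (f t y))) > 0)"

definition residual_in :: "'a topology \<Rightarrow> 'a set \<Rightarrow> bool" where
  "residual_in X S \<longleftrightarrow>
     S \<subseteq> topspace X \<and> (\<exists>G. G \<subseteq> S \<and> gdelta_in X G \<and> X closure_of G = topspace X)"


context
  fixes f :: "real \<Rightarrow> 'a::metric_space \<Rightarrow> 'a" and x :: 'a
  assumes semiflow: "semiflow f"
begin

definition visit_times :: "real \<Rightarrow> 'a set \<Rightarrow> real set" where
  "visit_times T U = {t\<in>{0..T}. f t x \<in> U}"

definition mean_visit :: "'a set \<Rightarrow> real \<Rightarrow> real" where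
  "mean_visit U T = (1 / T) * (LINT t:{0..T}|lborel. indicator U (f t x))"

lemma visit_times_fmeasurable:
  assumes "open U"
  shows "visit_times T U \<in> fmeasurable lborel"
proof -
  have "continuous_on ({0..} \<times> UNIV) (\<lambda>(t, x). f t x)"
    using semiflow by (simp add: semiflow_def)
  then have "continuous_on {0..T} (\<lambda>t. (\<lambda>(t, x). f t x) (t, x))"
  proof (rule continuous_on_compose2)
    show "continuous_on {0..T} (\<lambda>t. (t, x))"
      by (intro continuous_on_Pair continuous_on_id continuous_on_const)
  qed auto
  then have "continuous_on {0..T} (\<lambda>t. f t x)"
    by simp
  then have "\<exists>W. open W \<and> W \<inter> {0..T} = (\<lambda>t. f t x) -` U \<inter> {0..T}"
    by (rule continuous_on_open_invariant[THEN iffD1, rule_format, OF _ assms])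
  then obtain W where W: "open W" "W \<inter> {0..T} = (\<lambda>t. f t x) -` U \<inter> {0..T}"
    by (elim exE conjE) (rule that)
  have "visit_times T U = W \<inter> {0..T}"
    unfolding W(2) by (auto simp: visit_times_def)
  moreover have "{0..T} \<in> fmeasurable lborel"
    by (rule fmeasurable_compact) simp
  ultimately show ?thesis
    using W(1) fmeasurable_Int_fmeasurable[of "{0..T}" lborel W] by (simp add: Int_commute)
qed

lemma mean_visit_eq:
  "mean_visit U T = measure lborel (visit_times T U) / T"
proof -
  have "(\<lambda>t. indicator {0..T} t *\<^sub>R (indicator U (f t x) :: real)) = indicator (visit_times T U)"
    by (auto simp: visit_times_def indicator_def fun_eq_iff)
  then show ?thesis
    by (simp only: mean_visit_def set_lebesgue_integral_def Bochner_Integration.integral_indicator)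
      simp
qed

lemma mean_visit_nonneg: "T > 0 \<Longrightarrow> 0 \<le> mean_visit U T"
  by (simp add: mean_visit_eq)

lemma mean_visit_mono:
  assumes "T > 0" "open U" "open V" "U \<subseteq> V"
  shows "mean_visit U T \<le> mean_visit V T"
proof -
  have "measure lborel (visit_times T U) \<le> measure lborel (visit_times T V)"
    using assms(4) fmeasurableD[OF visit_times_fmeasurable[OF assms(2)]]
      visit_times_fmeasurable[OF assms(3)]
    by (intro measure_mono_fmeasurable) (auto simp: visit_times_def)
  with assms show ?thesis by (simp add: mean_visit_eq divide_right_mono)
qed

lemma mean_visit_Un_le:
  assumes "T > 0" "open U" "open V"
  shows "mean_visit (U \<union> V) T \<le> mean_visit U T + mean_visit V T"
proof -
  have *: "visit_times T (U \<union> V) = visit_times T U \<union> visit_times T V"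
    by (auto simp: visit_times_def)
  have "measure lborel (visit_times T (U \<union> V))
      \<le> measure lborel (visit_times T U) + measure lborel (visit_times T V)"
    unfolding * using visit_times_fmeasurable assms
    by (intro measure_Un_le) (meson fmeasurableD)+
  with assms show ?thesis
    by (simp add: mean_visit_eq add_divide_distrib[symmetric] divide_right_mono)
qed

lemma mean_visit_disjoint:
  assumes "T > 0" "open U" "open V" "U \<inter> V = {}"
  shows "mean_visit U T + mean_visit V T = mean_visit (U \<union> V) T"
proof -
  have *: "visit_times T (U \<union> V) = visit_times T U \<union> visit_times T V"
    by (auto simp: visit_times_def)
  have "measure lborel (visit_times T (U \<union> V))
      = measure lborel (visit_times T U) + measure lborel (visit_times T V)"
  proof -
    have "visit_times T U \<inter> visit_times T V = {}"
      using assms(4) by (auto simp: visit_times_def)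
    then show ?thesis
      unfolding * using measure_Un3[OF visit_times_fmeasurable[OF assms(2)]
        visit_times_fmeasurable[OF assms(3)], of T T] by simp
  qed
  with assms show ?thesis
    by (simp add: mean_visit_eq add_divide_distrib[symmetric])
qed

lemma mean_visit_all:
  assumes "T > 0" "orbit f x \<subseteq> U"
  shows "mean_visit U T = 1"
proof -
  have "visit_times T U = {0..T}"
    using assms by (auto simp: visit_times_def orbit_def)
  with assms show ?thesis by (simp add: mean_visit_eq)
qed

lemma mean_visit_le1:
  assumes "T > 0" "open U"
  shows "mean_visit U T \<le> 1"
  using mean_visit_mono[of T U UNIV] mean_visit_all[of T UNIV] assms by simp

lemma mean_visit_Union_tendsto_0:
  assumes "finite F" "\<And>U. U \<in> F \<Longrightarrow> open U \<and> (mean_visit U \<longlongrightarrow> 0) at_top"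
  shows "(mean_visit (\<Union>F) \<longlongrightarrow> 0) at_top"
  using assms
proof (induction F)
  case empty
  then show ?case by (simp add: mean_visit_def)
next
  case (insert U F)
  have "((\<lambda>T. mean_visit U T + mean_visit (\<Union>F) T) \<longlongrightarrow> 0 + 0) at_top"
    using insert by (intro tendsto_add) auto
  then have "((\<lambda>T. mean_visit U T + mean_visit (\<Union>F) T) \<longlongrightarrow> 0) at_top"
    by simp
  then show ?case
  proof (rule tendsto_sandwich[OF _ _ tendsto_const, rotated 2])
    show "\<forall>\<^sub>F T in at_top. 0 \<le> mean_visit (\<Union>(insert U F)) T"
      using eventually_gt_at_top[of 0] by eventually_elim (rule mean_visit_nonneg)
    have "open U" "open (\<Union>F)"
      using insert.prems by auto
    then have "mean_visit (\<Union>(insert U F)) T \<le> mean_visit U T + mean_visit (\<Union>F) T" if "T > 0" for T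
      using mean_visit_Un_le[OF that, of U "\<Union>F"] by simp
    then show "\<forall>\<^sub>F T in at_top. mean_visit (\<Union>(insert U F)) T
        \<le> mean_visit U T + mean_visit (\<Union>F) T"
      using eventually_gt_at_top[of 0] by (rule eventually_mono[rotated])
  qed
qed

lemma center_of_attraction_iff:
  "center_of_attraction f x C \<longleftrightarrow>
    closed C \<and> (\<forall>\<epsilon>>0. (mean_visit (nbhd \<epsilon> C) \<longlongrightarrow> 1) at_top)"
  unfolding center_of_attraction_def mean_visit_def by simp

lemma open_nbhd: "open (nbhd \<epsilon> C)"
  by (auto simp: nbhd_def)

lemma ex_least_center:
  assumes "lagrange_stable f x"
  obtains C where "center_of_attraction f x C"
    and "\<And>D. center_of_attraction f x D \<Longrightarrow> C \<subseteq> D"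
proof
  define C where "C = {y. \<forall>\<epsilon>>0. \<not> (mean_visit (ball y \<epsilon>) \<longlongrightarrow> 0) at_top}"
  have sub: "(mean_visit U \<longlongrightarrow> 0) at_top"
    if "(mean_visit V \<longlongrightarrow> 0) at_top" "U \<subseteq> V" "open U" "open V" for U V
  proof (rule tendsto_sandwich[OF _ _ tendsto_const that(1)])
    show "\<forall>\<^sub>F T in at_top. 0 \<le> mean_visit U T"
      using eventually_gt_at_top[of 0] by eventually_elim (rule mean_visit_nonneg)
    show "\<forall>\<^sub>F T in at_top. mean_visit U T \<le> mean_visit V T"
      using eventually_gt_at_top[of 0]
      by eventually_elim (rule mean_visit_mono[OF _ that(3,4,2)])
  qed
  have "open (- C)"
    unfolding open_dist
  proof
    fix y assume "y \<in> - C"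
    then obtain \<epsilon> where e: "\<epsilon> > 0" "(mean_visit (ball y \<epsilon>) \<longlongrightarrow> 0) at_top"
      by (auto simp: C_def)
    have "z \<in> - C" if "dist z y < \<epsilon> / 2" for z
    proof -
      have "ball z (\<epsilon> / 2) \<subseteq> ball y \<epsilon>"
      proof
        fix w assume "w \<in> ball z (\<epsilon> / 2)"
        then show "w \<in> ball y \<epsilon>"
          using that dist_triangle[of y w z] by (simp add: dist_commute)
      qed
      then have "(mean_visit (ball z (\<epsilon> / 2)) \<longlongrightarrow> 0) at_top"
        by (rule sub[OF e(2)]) (rule open_ball)+
      moreover have "\<epsilon> / 2 > 0" using e(1) by simp
      ultimately show ?thesis unfolding C_def by blast
    qed
    with e show "\<exists>\<epsilon>>0. \<forall>z. dist z y < \<epsilon> \<longrightarrow> z \<in> - C"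
      by (intro exI[of _ "\<epsilon> / 2"]) auto
  qed
  then have "closed C" by (simp add: closed_def)
  moreover have "(mean_visit (nbhd \<epsilon> C) \<longlongrightarrow> 1) at_top" if "\<epsilon> > 0" for \<epsilon>
  proof -
    let ?K = "closure (orbit f x) - nbhd \<epsilon> C"
    have "compact ?K"
      using assms by (intro compact_diff open_nbhd) (simp add: lagrange_stable_def)
    define \<U> where "\<U> = {U. open U \<and> (mean_visit U \<longlongrightarrow> 0) at_top}"
    have "?K \<subseteq> \<Union>\<U>"
    proof
      fix y assume "y \<in> ?K"
      then have "y \<notin> C" using \<open>\<epsilon> > 0\<close> by (auto simp: nbhd_def)
      then obtain \<delta> where "\<delta> > 0" "(mean_visit (ball y \<delta>) \<longlongrightarrow> 0) at_top"
        by (auto simp: C_def)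
      then show "y \<in> \<Union>\<U>"
        unfolding \<U>_def by (intro UnionI[of "ball y \<delta>"]) simp_all
    qed
    then obtain F where F: "F \<subseteq> \<U>" "finite F" "?K \<subseteq> \<Union>F"
    proof (rule compactE[OF \<open>compact ?K\<close>])
      show "open U" if "U \<in> \<U>" for U
        using that by (simp add: \<U>_def)
    qed (rule that)
    have V: "open (\<Union>F)" "(mean_visit (\<Union>F) \<longlongrightarrow> 0) at_top"
      using F by (auto simp: \<U>_def intro!: mean_visit_Union_tendsto_0)
    have cover: "orbit f x \<subseteq> nbhd \<epsilon> C \<union> \<Union>F"
      using F(3) closure_subset[of "orbit f x"] by blast
    have lower: "1 - mean_visit (\<Union>F) T \<le> mean_visit (nbhd \<epsilon> C) T" if "T > 0" for T
      using mean_visit_Un_le[OF that open_nbhd V(1), of \<epsilon> C] mean_visit_all[OF that cover]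
      by simp
    have "((\<lambda>T. 1 - mean_visit (\<Union>F) T) \<longlongrightarrow> 1 - 0) at_top"
      by (intro tendsto_intros V)
    then have lim: "((\<lambda>T. 1 - mean_visit (\<Union>F) T) \<longlongrightarrow> 1) at_top"
      by simp
    show ?thesis
    proof (rule tendsto_sandwich[OF _ _ lim tendsto_const])
      show "\<forall>\<^sub>F T in at_top. 1 - mean_visit (\<Union>F) T \<le> mean_visit (nbhd \<epsilon> C) T"
        using eventually_gt_at_top[of 0] by eventually_elim (rule lower)
      show "\<forall>\<^sub>F T in at_top. mean_visit (nbhd \<epsilon> C) T \<le> 1"
        using eventually_gt_at_top[of 0] by eventually_elim (rule mean_visit_le1[OF _ open_nbhd])
    qed
  qed
  ultimately show "center_of_attraction f x C"
    by (simp add: center_of_attraction_iff)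
  show "C \<subseteq> D" if D: "center_of_attraction f x D" for D
  proof
    fix y assume "y \<in> C"
    show "y \<in> D"
    proof (rule ccontr)
      assume "y \<notin> D"
      moreover have "open (- D)" using D by (auto simp: center_of_attraction_def)
      ultimately obtain \<epsilon> where e: "\<epsilon> > 0" "ball y \<epsilon> \<subseteq> - D"
        by (auto elim: openE)
      have disj: "ball y (\<epsilon> / 2) \<inter> nbhd (\<epsilon> / 2) D = {}"
      proof (rule ccontr)
        assume "ball y (\<epsilon> / 2) \<inter> nbhd (\<epsilon> / 2) D \<noteq> {}"
        then obtain z c where "c \<in> D" "dist c z < \<epsilon> / 2" "dist y z < \<epsilon> / 2"
          by (auto simp: nbhd_def)
        moreover have "dist y c \<le> dist y z + dist c z" by (rule dist_triangle2)
        ultimately have "c \<in> ball y \<epsilon>" by simp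
        with e \<open>c \<in> D\<close> show False by blast
      qed
      have upper: "mean_visit (ball y (\<epsilon> / 2)) T \<le> 1 - mean_visit (nbhd (\<epsilon> / 2) D) T" if "T > 0" for T
        using mean_visit_disjoint[OF that open_ball open_nbhd disj]
          mean_visit_le1[OF that, of "ball y (\<epsilon> / 2) \<union> nbhd (\<epsilon> / 2) D",
            OF open_Un[OF open_ball open_nbhd]]
        by linarith
      have "(mean_visit (nbhd (\<epsilon> / 2) D) \<longlongrightarrow> 1) at_top"
        using D e(1) by (simp add: center_of_attraction_iff)
      from tendsto_diff[OF tendsto_const this, of 1]
      have lim: "((\<lambda>T. 1 - mean_visit (nbhd (\<epsilon> / 2) D) T) \<longlongrightarrow> 0) at_top"
        by simp
      have "(mean_visit (ball y (\<epsilon> / 2)) \<longlongrightarrow> 0) at_top"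
      proof (rule tendsto_sandwich[OF _ _ tendsto_const lim])
        show "\<forall>\<^sub>F T in at_top. 0 \<le> mean_visit (ball y (\<epsilon> / 2)) T"
          using eventually_gt_at_top[of 0] by eventually_elim (rule mean_visit_nonneg)
        show "\<forall>\<^sub>F T in at_top. mean_visit (ball y (\<epsilon> / 2)) T
            \<le> 1 - mean_visit (nbhd (\<epsilon> / 2) D) T"
          using eventually_gt_at_top[of 0] by eventually_elim (rule upper)
      qed
      with e(1) \<open>y \<in> C\<close> show False unfolding C_def using half_gt_zero by blast
    qed
  qed
qed

lemma ex1_minimal_center:
  assumes "lagrange_stable f x"
  shows "\<exists>!C. is_minimal_center f x C"
proof -
  obtain C where C: "center_of_attraction f x C"
    "\<And>D. center_of_attraction f x D \<Longrightarrow> C \<subseteq> D"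
    using ex_least_center[OF assms] by blast
  show ?thesis
  proof (rule ex1I)
    show "is_minimal_center f x C"
      unfolding is_minimal_center_def using C by (meson leD)
    show "D = C" if "is_minimal_center f x D" for D
    proof (rule ccontr)
      assume "D \<noteq> C"
      moreover have "C \<subseteq> D"
        using that C(2) by (simp add: is_minimal_center_def)
      ultimately have "C \<subset> D" by blast
      with that C(1) show False unfolding is_minimal_center_def by blast
    qed
  qed
qed

lemma is_minimal_center_minimal_center:
  assumes "lagrange_stable f x"
  shows "is_minimal_center f x (minimal_center f x)"
  unfolding minimal_center_def by (rule theI'[OF ex1_minimal_center[OF assms]])

end

end

theory Submission
  imports Defs
begin

text \<open>Every tail of the motion of a generic point \<open>q\<close> is dense in \<open>C = \<C>\<^sub>p = \<C>\<^sub>q\<close>, so the points of \<open>C\<close>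
  that visit every nonempty relatively open subset of \<open>C\<close> at arbitrarily large times form a
  \<open>G\<^sub>\<delta>\<close> containing the dense orbit of \<open>q\<close>.  Let \<open>x\<close> be such a point and \<open>N\<close> a proper nonempty
  closed invariant subset of \<open>C\<close>.  By the Auslander--Ellis argument some \<open>y \<in> N\<close> is proximal
  to \<open>x\<close>.  As \<open>y\<close> never leaves \<open>N\<close> while \<open>x\<close> keeps returning to a ball at positive distance
  from \<open>N\<close>, both limits superior are positive.\<close>

section \<open>The topology of pointwise convergence on maps\<close>

lemma compact_fun_imp_closed:
  fixes T :: "('a \<Rightarrow> 'b::t2_space) set"
  assumes "compact T"
  shows "closed T"
proof -
  have "Hausdorff_space (euclidean :: ('a \<Rightarrow> 'b) topology)"
    unfolding euclidean_product_topology[symmetric] Hausdorff_space_product_topology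
    by (auto simp: Hausdorff_space_def disjnt_def dest!: hausdorff)
  then show ?thesis
    using assms compactin_imp_closedin by (metis closed_closedin compactin_euclidean_iff)
qed

text \<open>Tychonoff's theorem. Factors depending on the index later allow singleton factors at the
  points off a compact set.\<close>

lemma compact_PiE_UNIV:
  fixes K :: "'a \<Rightarrow> 'b::topological_space set"
  assumes "\<And>i. compact (K i)"
  shows "compact (PiE UNIV K)"
  using compactin_PiE[of "\<lambda>_. euclidean" UNIV K] assms
  unfolding euclidean_product_topology by simp

lemma closed_eval_vimage:
  fixes A :: "'b::topological_space set"
  assumes "closed A"
  shows "closed {p. p x \<in> A}"
proof -
  have "closed ((\<lambda>p. p x) -` A)"
    by (rule closed_vimage[OF assms continuous_on_product_coordinates])
  then show ?thesis by (simp add: vimage_def)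
qed

text \<open>The coordinate of \<open>p \<circ> q\<close> at a point \<open>x\<close> is the
  projection of \<open>p\<close> to the coordinate \<open>q x\<close>.\<close>

lemma continuous_on_comp_right: "continuous_on S (\<lambda>p. p \<circ> q)"
  for S :: "('a \<Rightarrow> 'b::topological_space) set"
  unfolding comp_def
  by (intro continuous_on_coordinatewise_then_product
      continuous_on_subset[OF continuous_on_product_coordinates]) simp

section \<open>Idempotents in compact semigroups of maps\<close>

text \<open>The Ellis--Numakura lemma. Multiplication only has to be continuous in its left factor,
  which composition always is for the topology of pointwise convergence.\<close>

lemma ex_idempotent_comp:
  fixes S :: "('a \<Rightarrow> 'a::t2_space) set"
  assumes S: "compact S" "S \<noteq> {}" and comp: "\<And>p q. p \<in> S \<Longrightarrow> q \<in> S \<Longrightarrow> p \<circ> q \<in> S"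
  obtains u where "u \<in> S" "u \<circ> u = u"
proof -
  define sub where "sub T \<longleftrightarrow> T \<subseteq> S \<and> T \<noteq> {} \<and> closed T \<and> (\<forall>p\<in>T. \<forall>q\<in>T. p \<circ> q \<in> T)" for T
  have "sub S"
    using S comp compact_fun_imp_closed[OF S(1)] by (simp add: sub_def)
  \<comment> \<open>A minimal closed subsemigroup is the complement of a maximal element here, so
    Zorn's lemma is applied to complements and chains are bounded by their unions.\<close>
  have "\<exists>M\<in>{A. sub (- A)}. \<forall>X\<in>{A. sub (- A)}. M \<subseteq> X \<longrightarrow> X = M"
  proof (rule subset_Zorn_nonempty)
    show "{A. sub (- A)} \<noteq> {}"
      using \<open>sub S\<close> by (auto intro!: exI[of _ "- S"])
    fix \<C> assume "\<C> \<noteq> {}" and chain: "subset.chain {A. sub (- A)} \<C>"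
    have sub: "sub (- A)" if "A \<in> \<C>" for A
      using chain that unfolding subset_chain_def by blast
    have lin: "A \<subseteq> B \<or> B \<subseteq> A" if "A \<in> \<C>" "B \<in> \<C>" for A B
      using chain that unfolding subset_chain_def by blast
    have "S \<inter> \<Inter>(uminus ` \<C>) \<noteq> {}"
    proof (rule compact_imp_fip[OF S(1)])
      show "closed T" if "T \<in> uminus ` \<C>" for T
        using that sub by (auto simp: sub_def)
      fix F assume F: "finite F" "F \<subseteq> uminus ` \<C>"
      obtain G where G: "G \<subseteq> \<C>" "finite G" "F = uminus ` G"
        using F by (meson finite_subset_image)
      \<comment> \<open>A finite part of a chain lies below one member; the complement of that
        member supplies the point for the finite intersection property.\<close>
      have "\<exists>A\<in>\<C>. \<Union>G \<subseteq> A"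
        using G(2,1)
      proof (induction G)
        case empty
        then show ?case using \<open>\<C> \<noteq> {}\<close> by auto
      next
        case (insert B G)
        then obtain A where "A \<in> \<C>" "\<Union>G \<subseteq> A" by auto
        moreover have "B \<in> \<C>" using insert.prems by simp
        ultimately show ?case
          using lin[of A B] by (intro bexI[of _ "A \<union> B"]) (auto simp: sup.absorb1 sup.absorb2)
      qed
      then obtain A where A: "A \<in> \<C>" "\<Union>G \<subseteq> A" by (rule bexE)
      obtain q where q: "q \<in> - A" "q \<in> S" using sub[OF A(1)] by (auto simp: sub_def)
      have "q \<in> \<Inter>F" using A(2) q(1) by (auto simp: G(3))
      with q(2) show "S \<inter> \<Inter>F \<noteq> {}" by auto
    qed
    moreover have "- \<Union>\<C> = \<Inter>(uminus ` \<C>)"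
      by auto
    moreover have "closed (\<Inter>(uminus ` \<C>))"
      using sub by (intro closed_Inter) (auto simp: sub_def)
    moreover have "\<Inter>(uminus ` \<C>) \<subseteq> S"
      using sub \<open>\<C> \<noteq> {}\<close> by (fastforce simp: sub_def)
    moreover have "p \<circ> q \<in> \<Inter>(uminus ` \<C>)" if "p \<in> \<Inter>(uminus ` \<C>)" "q \<in> \<Inter>(uminus ` \<C>)" for p q
    proof (rule InterI)
      fix B assume "B \<in> uminus ` \<C>"
      then have "sub B" "p \<in> B" "q \<in> B" using sub that by auto
      then show "p \<circ> q \<in> B" by (simp add: sub_def)
    qed
    ultimately have "sub (- \<Union>\<C>)"
      unfolding sub_def by (intro conjI ballI) (simp_all add: Int_absorb1 del: Inter_iff)
    then show "\<Union>\<C> \<in> {A. sub (- A)}" by simp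
  qed
  then obtain M where M: "sub (- M)" "\<And>X. sub (- X) \<Longrightarrow> M \<subseteq> X \<Longrightarrow> X = M"
    by auto
  define T where "T = - M"
  have T: "T \<subseteq> S" "T \<noteq> {}" "closed T" "\<And>p q. p \<in> T \<Longrightarrow> q \<in> T \<Longrightarrow> p \<circ> q \<in> T"
    using M(1) by (auto simp: T_def sub_def)
  have minimal: "R = T" if "sub R" "R \<subseteq> T" for R
    using M(2)[of "- R"] that by (auto simp: T_def)
  obtain u where u: "u \<in> T" using T(2) by blast
  have "compact T"
    using S(1) T(1,3) compact_Int_closed[of S T] by (simp add: Int_absorb1)
  \<comment> \<open>The right translate of \<open>T\<close> by \<open>u\<close> is a closed
    subsemigroup inside \<open>T\<close>, hence all of \<open>T\<close>. So \<open>u\<close> itself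
    has the form \<open>v \<circ> u\<close>.\<close>
  have "sub ((\<lambda>p. p \<circ> u) ` T)"
    unfolding sub_def
  proof (intro conjI)
    show "closed ((\<lambda>p. p \<circ> u) ` T)"
      by (intro compact_fun_imp_closed compact_continuous_image continuous_on_comp_right \<open>compact T\<close>)
    show "\<forall>p\<in>(\<lambda>p. p \<circ> u) ` T. \<forall>q\<in>(\<lambda>p. p \<circ> u) ` T. p \<circ> q \<in> (\<lambda>p. p \<circ> u) ` T"
    proof clarify
      fix p q assume "p \<in> T" "q \<in> T"
      then have "(p \<circ> u \<circ> q) \<in> T" using T(4) u by blast
      then show "(p \<circ> u) \<circ> (q \<circ> u) \<in> (\<lambda>p. p \<circ> u) ` T"
        by (rule rev_image_eqI) (simp add: comp_assoc)
    qed
  qed (use T u in auto)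
  then have "(\<lambda>p. p \<circ> u) ` T = T"
    using T(4) u by (intro minimal) auto
  then obtain v where v: "v \<in> T" "v \<circ> u = u"
    using u by (metis (no_types, lifting) imageE)
  \<comment> \<open>By \<open>v\<close> this set is nonempty; as a closed subsemigroup it exhausts
    the minimal \<open>T\<close>, so it contains \<open>u\<close>.\<close>
  define R where "R = {p \<in> T. p \<circ> u = u}"
  \<comment> \<open>Closedness is read off coordinatewise: \<open>p \<circ> u = u\<close> prescribes
    the value of \<open>p\<close> at each \<open>u x\<close>.\<close>
  have "R = T \<inter> (\<Inter>x. {p. p (u x) \<in> {u x}})"
    by (auto simp: R_def fun_eq_iff)
  moreover have "closed (T \<inter> (\<Inter>x. {p. p (u x) \<in> {u x}}))"
    by (intro closed_Int T(3) closed_INT ballI closed_eval_vimage closed_singleton)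
  ultimately have "closed R" by simp
  moreover have "p \<circ> q \<in> R" if "p \<in> R" "q \<in> R" for p q
    using that T(4) by (auto simp: R_def comp_assoc)
  ultimately have "sub R"
    using v T(1) by (auto simp: sub_def R_def)
  then have "R = T" by (rule minimal) (auto simp: R_def)
  with u have "u \<circ> u = u" by (auto simp: R_def)
  with u T(1) show ?thesis using that by blast
qed

section \<open>The enveloping semigroup and proximal points\<close>

lemma semiflow_continuous_on:
  assumes "semiflow f" "t \<ge> 0"
  shows "continuous_on A (f t)"
proof -
  have "continuous_on ({0..} \<times> UNIV) (\<lambda>(t, x). f t x)"
    using assms(1) by (simp add: semiflow_def)
  then have "continuous_on A (\<lambda>x. (\<lambda>(t, x). f t x) (t, x))"
    using assms(2)
    by (rule_tac continuous_on_compose2[where f = "Pair t"]) (auto intro!: continuous_intros)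
  then show ?thesis by simp
qed

lemma semiflow_add:
  "semiflow f \<Longrightarrow> s \<ge> 0 \<Longrightarrow> t \<ge> 0 \<Longrightarrow> f t (f s x) = f (s + t) x"
  by (simp add: semiflow_def)

text \<open>The Auslander--Ellis argument: an idempotent \<open>u\<close> of the enveloping semigroup with
  \<open>u x \<in> N\<close> satisfies \<open>u (u x) = u x\<close>, so \<open>u x\<close> is proximal to \<open>x\<close>.\<close>

lemma ex_proximal:
  fixes f :: "real \<Rightarrow> 'a::metric_space \<Rightarrow> 'a"
  assumes f: "semiflow f" and C: "compact C" "invariant f C" and x: "x \<in> C"
    and N: "N \<noteq> {}" "closed N" "invariant f N" "N \<subseteq> C" "N \<subseteq> closure (orbit f x)"
  obtains y where "y \<in> N" "\<And>\<epsilon>. \<epsilon> > 0 \<Longrightarrow> \<exists>t\<ge>0. dist (f t x) (f t y) < \<epsilon>"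
proof -
  \<comment> \<open>Replacing \<open>f t\<close> by the identity off \<open>C\<close> puts all
    \<open>g t\<close> into the compact product \<open>K\<close>, even if the whole space is not
    compact. Their closure \<open>E\<close> is the enveloping semigroup.\<close>
  define g where "g t z = (if z \<in> C then f t z else z)" for t z
  define K where "K = PiE UNIV (\<lambda>z. if z \<in> C then C else {z})"
  define E where "E = closure (g ` {0..})"
  have "compact K" unfolding K_def by (rule compact_PiE_UNIV) (simp add: C(1))
  have gK: "g ` {0..} \<subseteq> K"
    using C(2) by (auto simp: g_def K_def invariant_def)
  have "closed K" using \<open>compact K\<close> by (rule compact_fun_imp_closed)
  have EK: "E \<subseteq> K" unfolding E_def by (rule closure_minimal[OF gK \<open>closed K\<close>])
  have KD: "q z \<in> (if z \<in> C then C else {z})" if "q \<in> K" for q z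
    using that unfolding K_def by (rule PiE_mem) simp
  have E_in: "q z \<in> C" if "q \<in> E" "z \<in> C" for q z
    using KD[of q z] EK that by auto
  have E_out: "q z = z" if "q \<in> E" "z \<notin> C" for q z
    using KD[of q z] EK that by auto
  have "closed E" by (simp add: E_def)
  have "compact E"
    using compact_Int_closed[OF \<open>compact K\<close> \<open>closed E\<close>] EK by (simp add: Int_absorb1)
  have gE: "g t \<in> E" if "t \<ge> 0" for t
    using that closure_subset[of "g ` {0..}"] by (auto simp: E_def)
  have g_comp: "g s \<circ> g t = g (s + t)" if "s \<ge> 0" "t \<ge> 0" for s t
    using that C(2) f by (auto simp: g_def fun_eq_iff invariant_def semiflow_add add.commute)
  \<comment> \<open>On \<open>E\<close>, coordinates in \<open>C\<close> are composed with the
    continuous \<open>f t\<close> and the others are constant. Left multiplication by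
    \<open>g t\<close> is thus continuous; it permits passing from generators to their
    closure.\<close>
  have left: "g t \<circ> q \<in> E" if t: "t \<ge> 0" and q: "q \<in> E" for t q
  proof -
    have "continuous_on E (\<lambda>q. g t \<circ> q)"
    proof (rule continuous_on_coordinatewise_then_product)
      fix z
      show "continuous_on E (\<lambda>q. (g t \<circ> q) z)"
      proof (cases "z \<in> C")
        case True
        have "continuous_on E (\<lambda>q. f t (q z))"
          by (rule continuous_on_compose2[OF semiflow_continuous_on[OF f t, of UNIV]
                continuous_on_subset[OF continuous_on_product_coordinates]]) auto
        moreover have "(g t \<circ> q) z = f t (q z)" if "q \<in> E" for q
          using E_in[OF that True] by (simp add: g_def)
        ultimately show ?thesis
          by (subst continuous_on_cong[OF refl])
      next
        case False
        then have "(g t \<circ> q) z = z" if "q \<in> E" for q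
          using E_out[OF that False] by (simp add: g_def)
        then show ?thesis
          by (subst continuous_on_cong[OF refl]) (auto intro: continuous_on_const)
      qed
    qed
    then have "(\<lambda>q. g t \<circ> q) ` E \<subseteq> E"
      unfolding E_def by (rule image_closure_subset) (use g_comp gE t in \<open>auto simp: E_def\<close>)
    with q show ?thesis by blast
  qed
  have E_comp: "p \<circ> q \<in> E" if "p \<in> E" "q \<in> E" for p q
  proof -
    \<comment> \<open>Now the left factor runs through the closure: right multiplication by
      \<open>q\<close> is continuous and, by \<open>left\<close>, carries every generator into
      \<open>E\<close>.\<close>
    have "(\<lambda>p. p \<circ> q) ` E \<subseteq> E"
      unfolding E_def
    proof (rule image_closure_subset[OF continuous_on_comp_right])
      show "(\<lambda>p. p \<circ> q) ` g ` {0..} \<subseteq> closure (g ` {0..})"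
        using left that(2) by (auto simp: E_def)
    qed simp
    with that show ?thesis by blast
  qed
  have E_N: "p z \<in> N" if "p \<in> E" "z \<in> N" for p z
  proof -
    have "E \<subseteq> {p. p z \<in> N}"
      unfolding E_def
    proof (rule closure_minimal)
      show "g ` {0..} \<subseteq> {p. p z \<in> N}"
        using N(3,4) that(2) by (auto simp: g_def invariant_def)
    qed (rule closed_eval_vimage[OF N(2)])
    with that show ?thesis by blast
  qed
  \<comment> \<open>A subsemigroup: \<open>q x\<close> lies in \<open>N\<close>, and every element
    of \<open>E\<close> preserves \<open>N\<close>.\<close>
  define S where "S = E \<inter> {p. p x \<in> N}"
  have "compact S"
    unfolding S_def by (rule compact_Int_closed[OF \<open>compact E\<close> closed_eval_vimage[OF N(2)]])
  \<comment> \<open>The compact image contains the orbit and hence its closure, so each point of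
    \<open>N\<close> is \<open>p x\<close> for some \<open>p\<close> in \<open>E\<close>. This makes
    \<open>S\<close> nonempty.\<close>
  have "compact ((\<lambda>p. p x) ` E)"
    using \<open>compact E\<close>
    by (intro compact_continuous_image continuous_on_subset[OF continuous_on_product_coordinates]) auto
  moreover have "orbit f x \<subseteq> (\<lambda>p. p x) ` E"
  proof
    fix w assume "w \<in> orbit f x"
    then obtain t where "t \<ge> 0" "w = f t x" by (auto simp: orbit_def)
    then show "w \<in> (\<lambda>p. p x) ` E"
      using x gE[of t] by (intro image_eqI[of _ _ "g t"]) (auto simp: g_def)
  qed
  ultimately have "closure (orbit f x) \<subseteq> (\<lambda>p. p x) ` E"
    by (intro closure_minimal compact_imp_closed)
  then have "S \<noteq> {}" using N(1,5) by (auto simp: S_def)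
  moreover have "p \<circ> q \<in> S" if "p \<in> S" "q \<in> S" for p q
    using that E_comp E_N by (auto simp: S_def)
  ultimately obtain u where u: "u \<in> S" "u \<circ> u = u"
    using ex_idempotent_comp[OF \<open>compact S\<close>] by metis
  have uu: "u (u x) = u x" using u(2) by (metis comp_apply)
  show thesis
  proof (rule that)
    show "u x \<in> N" using u(1) by (simp add: S_def)
    then have "u x \<in> C" using N(4) by blast
    fix \<epsilon> :: real assume "\<epsilon> > 0"
    \<comment> \<open>Since \<open>u\<close> sends both \<open>x\<close> and \<open>u x\<close> to
      \<open>u x\<close>, this is a neighbourhood of \<open>u\<close>. Any \<open>g t\<close> in it
      brings the two points within \<open>\<epsilon>/2\<close> of \<open>u x\<close>.\<close>
    define W where "W = {p. p x \<in> ball (u x) (\<epsilon>/2)} \<inter> {p. p (u x) \<in> ball (u x) (\<epsilon>/2)}"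
    have "open {p. p z \<in> ball (u x) (\<epsilon>/2)}" for z
      using closed_eval_vimage[of "- ball (u x) (\<epsilon>/2)" z]
      by (simp add: closed_def Collect_neg_eq[symmetric])
    then have "open W" unfolding W_def by (intro open_Int)
    moreover have "u \<in> W" using \<open>\<epsilon> > 0\<close> by (simp add: W_def uu)
    moreover have "u \<in> closure (g ` {0..})" using u(1) by (simp add: S_def E_def)
    ultimately have "W \<inter> g ` {0..} \<noteq> {}"
      using open_Int_closure_eq_empty[of W "g ` {0..}"] by auto
    then obtain t where t: "t \<ge> 0" "g t \<in> W" by auto
    have "dist (f t x) (f t (u x)) < \<epsilon>"
      using t(2) x \<open>u x \<in> C\<close> dist_triangle_half_r[of "u x" "f t x" \<epsilon> "f t (u x)"]
      by (auto simp: W_def g_def)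
    with t(1) show "\<exists>t\<ge>0. dist (f t x) (f t (u x)) < \<epsilon>" by blast
  qed
qed

section \<open>Recurrence of a motion to its minimal center\<close>

text \<open>Minimality by itself only excludes proper subsets; Lagrange stability supplies a least
  center, which minimality forces to equal \<open>C\<close>.\<close>

lemma minimal_center_le:
  assumes "semiflow f" "lagrange_stable f x" "is_minimal_center f x C" "center_of_attraction f x D"
  shows "C \<subseteq> D"
proof -
  obtain L where L: "center_of_attraction f x L"
    "\<And>D. center_of_attraction f x D \<Longrightarrow> L \<subseteq> D"
    using ex_least_center[OF assms(1,2)] by metis
  have "L \<subseteq> C" using L(2) assms(3) by (simp add: is_minimal_center_def)
  moreover have "\<not> L \<subset> C" using L(1) assms(3) by (auto simp: is_minimal_center_def)
  ultimately have "L = C" by blast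
  then show ?thesis using L(2)[OF assms(4)] by simp
qed

text \<open>The motion can leave the neighbourhood only before time \<open>k\<close>, which is a
  fraction of at most \<open>k / T\<close> of the time up to \<open>T\<close>.\<close>

lemma center_of_attraction_tail:
  assumes f: "semiflow f" and "k \<ge> 0"
  shows "center_of_attraction f x (closure ((\<lambda>t. f t x) ` {k..}))" (is "center_of_attraction f x ?D")
  unfolding center_of_attraction_iff[OF f]
proof (intro conjI allI impI)
  fix \<epsilon> :: real assume "\<epsilon> > 0"
  have lower: "1 - k / T \<le> mean_visit f x (nbhd \<epsilon> ?D) T" if T: "T > k" for T
  proof -
    have "f t x \<in> nbhd \<epsilon> ?D" if "t \<ge> k" for t
      using that \<open>\<epsilon> > 0\<close> closure_subset[of "(\<lambda>t. f t x) ` {k..}"]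
      by (auto simp: nbhd_def intro!: bexI[of _ "f t x"])
    then have "{k..T} \<subseteq> visit_times f x T (nbhd \<epsilon> ?D)"
      using \<open>k \<ge> 0\<close> by (auto simp: visit_times_def[OF f])
    then have "measure lborel {k..T} \<le> measure lborel (visit_times f x T (nbhd \<epsilon> ?D))"
      by (intro measure_mono_fmeasurable visit_times_fmeasurable[OF f] open_nbhd[OF f]) auto
    then have "(T - k) / T \<le> measure lborel (visit_times f x T (nbhd \<epsilon> ?D)) / T"
      using T \<open>k \<ge> 0\<close> by (intro divide_right_mono) auto
    then show ?thesis
      using T \<open>k \<ge> 0\<close> by (simp add: mean_visit_eq[OF f] diff_divide_distrib)
  qed
  have "((\<lambda>T. 1 - k / T) \<longlongrightarrow> 1 - 0) at_top"
    by (intro tendsto_intros tendsto_divide_0[OF tendsto_const] filterlim_at_top_imp_at_infinity filterlim_ident)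
  then have lim: "((\<lambda>T. 1 - k / T) \<longlongrightarrow> 1) at_top" by simp
  show "(mean_visit f x (nbhd \<epsilon> ?D) \<longlongrightarrow> 1) at_top"
  proof (rule tendsto_sandwich[OF _ _ lim tendsto_const])
    show "\<forall>\<^sub>F T in at_top. 1 - k / T \<le> mean_visit f x (nbhd \<epsilon> ?D) T"
      using eventually_gt_at_top[of k] by eventually_elim (rule lower)
    show "\<forall>\<^sub>F T in at_top. mean_visit f x (nbhd \<epsilon> ?D) T \<le> 1"
      using eventually_gt_at_top[of 0]
      by eventually_elim (rule mean_visit_le1[OF f _ open_nbhd[OF f]])
  qed
qed simp

lemma minimal_center_subset_closure_tail:
  assumes "semiflow f" "lagrange_stable f x" "is_minimal_center f x C" "k \<ge> 0"
  shows "C \<subseteq> closure ((\<lambda>t. f t x) ` {k..})"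
  using minimal_center_le[OF assms(1-3) center_of_attraction_tail[OF assms(1,4)]] .

text \<open>Supplies, for the generic point, the late visits that define the residual set.\<close>

lemma minimal_center_visits:
  assumes "semiflow f" "lagrange_stable f x" "is_minimal_center f x C" "k \<ge> 0"
    and "open U" "U \<inter> C \<noteq> {}"
  obtains t where "t \<ge> k" "f t x \<in> U"
proof -
  have "U \<inter> closure ((\<lambda>t. f t x) ` {k..}) \<noteq> {}"
    using minimal_center_subset_closure_tail[OF assms(1-4)] assms(6) by blast
  then have "U \<inter> (\<lambda>t. f t x) ` {k..} \<noteq> {}"
    using open_Int_closure_eq_empty[OF assms(5)] by blast
  then show ?thesis using that by auto
qed

section \<open>From late visits and proximality to chaos\<close>

lemma Liminf_ereal_eq_0I:
  fixes g :: "real \<Rightarrow> real"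
  assumes "\<And>t. g t \<ge> 0" and "\<And>\<epsilon> T. \<epsilon> > 0 \<Longrightarrow> \<exists>t\<ge>T. g t < \<epsilon>"
  shows "Liminf at_top (\<lambda>t. ereal (g t)) = 0"
proof (rule antisym)
  show "Liminf at_top (\<lambda>t. ereal (g t)) \<le> 0"
  proof (rule ccontr)
    assume "\<not> ?thesis"
    then obtain \<epsilon> where e: "0 < ereal \<epsilon>" "ereal \<epsilon> < Liminf at_top (\<lambda>t. ereal (g t))"
      using ereal_dense2 by (metis not_le)
    from less_LiminfD[OF e(2)] obtain T where "\<And>t. t \<ge> T \<Longrightarrow> g t > \<epsilon>"
      by (auto simp: eventually_at_top_linorder)
    moreover obtain t where "t \<ge> T" "g t < \<epsilon>" using assms(2)[of \<epsilon> T] e(1) by auto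
    ultimately show False by (meson less_asym)
  qed
  show "0 \<le> Liminf at_top (\<lambda>t. ereal (g t))"
    using assms(1) by (intro Liminf_bounded) simp
qed

lemma Limsup_ereal_gt_0I:
  fixes g :: "real \<Rightarrow> real"
  assumes "\<delta> > 0" and "\<And>T. \<exists>t\<ge>T. g t \<ge> \<delta>"
  shows "Limsup at_top (\<lambda>t. ereal (g t)) > 0"
proof (rule ccontr)
  assume "\<not> ?thesis"
  then have "Limsup at_top (\<lambda>t. ereal (g t)) < ereal \<delta>"
    using assms(1) by (meson ereal_less(2) not_le order_le_less_trans)
  from Limsup_lessD[OF this] obtain T where "\<And>t. t \<ge> T \<Longrightarrow> g t < \<delta>"
    by (auto simp: eventually_at_top_linorder)
  moreover obtain t where "t \<ge> T" "g t \<ge> \<delta>" using assms(2) by blast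
  ultimately show False by (meson not_le)
qed

text \<open>Uniform continuity of \<open>f s\<close> on the compact \<open>C\<close> carries
  closeness at one time \<open>t\<close> over to the time \<open>t + s\<close>.\<close>

lemma proximal_at_large_times:
  assumes f: "semiflow f" and C: "compact C" "invariant f C" and "x \<in> C" "y \<in> C"
    and prox: "\<And>\<epsilon>. \<epsilon> > 0 \<Longrightarrow> \<exists>t\<ge>0. dist (f t x) (f t y) < \<epsilon>"
    and "\<epsilon> > 0"
  shows "\<exists>t\<ge>T. dist (f t x) (f t y) < \<epsilon>"
proof -
  \<comment> \<open>The maximum keeps \<open>s\<close> an admissible time when \<open>T\<close> is
    negative.\<close>
  define s where "s = max T 0"
  have "uniformly_continuous_on C (f s)"
    by (intro compact_uniformly_continuous semiflow_continuous_on f C(1)) (simp add: s_def)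
  then obtain \<delta> where d: "\<delta> > 0"
    "\<And>a b. a \<in> C \<Longrightarrow> b \<in> C \<Longrightarrow> dist b a < \<delta> \<Longrightarrow> dist (f s b) (f s a) < \<epsilon>"
    using \<open>\<epsilon> > 0\<close> unfolding uniformly_continuous_on_def by metis
  obtain t where t: "t \<ge> 0" "dist (f t x) (f t y) < \<delta>" using prox[OF d(1)] by blast
  have "dist (f s (f t x)) (f s (f t y)) < \<epsilon>"
    using C(2) assms(4,5) t by (intro d(2)) (auto simp: invariant_def)
  then have "dist (f (t + s) x) (f (t + s) y) < \<epsilon>"
    using f t(1) by (simp add: semiflow_add s_def)
  moreover have "t + s \<ge> T" using t(1) by (simp add: s_def)
  ultimately show ?thesis by blast
qed

text \<open>Time averages no longer enter, only late visits. They bring \<open>x\<close> near the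
  proximal point \<open>y\<close>, which lies in \<open>C\<close>, and also near a point off
  \<open>N\<close>.\<close>

lemma chaotic_if_transitive:
  fixes f :: "real \<Rightarrow> 'a::metric_space \<Rightarrow> 'a"
  assumes f: "semiflow f" and C: "compact C" "invariant f C" and x: "x \<in> C"
    and visits: "\<And>U T. open U \<Longrightarrow> U \<inter> C \<noteq> {} \<Longrightarrow> \<exists>t\<ge>T. 0 \<le> t \<and> f t x \<in> U"
    and N: "N \<noteq> {}" "closed N" "invariant f N" "N \<subset> C"
  shows "chaotic f x"
proof -
  have "C \<subseteq> closure (orbit f x)"
  proof (rule ccontr)
    assume "\<not> ?thesis"
    then have "- closure (orbit f x) \<inter> C \<noteq> {}" by auto
    then obtain t where "t \<ge> 0" "f t x \<notin> closure (orbit f x)"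
      using visits[of "- closure (orbit f x)"] by auto
    then show False using closure_subset[of "orbit f x"] by (auto simp: orbit_def)
  qed
  then obtain y where y: "y \<in> N" "\<And>\<epsilon>. \<epsilon> > 0 \<Longrightarrow> \<exists>t\<ge>0. dist (f t x) (f t y) < \<epsilon>"
    using ex_proximal[OF f C x N(1-3)] N(4) by (metis order_trans psubset_imp_subset)
  have yC: "y \<in> C" using y(1) N(4) by blast
  obtain z where z: "z \<in> C" "z \<notin> N" using N(4) by blast
  obtain \<delta> where d: "\<delta> > 0" "ball z \<delta> \<subseteq> - N"
    using z(2) N(2) openE[of "- N" z] by (auto simp: closed_def)
  have near: "\<exists>t\<ge>T. 0 \<le> t \<and> dist (f t x) w < \<epsilon>" if "w \<in> C" "\<epsilon> > 0" for w \<epsilon> T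
  proof -
    have "w \<in> ball w \<epsilon> \<inter> C" using that by simp
    then have "ball w \<epsilon> \<inter> C \<noteq> {}" by blast
    from visits[OF open_ball this, of T] show ?thesis by (auto simp: dist_commute)
  qed
  \<comment> \<open>A point within \<open>\<delta> / 2\<close> of \<open>z\<close> is at least
    \<open>\<delta> / 2\<close> away from all of \<open>N\<close>. Uniformity over \<open>N\<close>
    serves both the fixed \<open>y\<close> and the moving \<open>f t y\<close>.\<close>
  have far: "\<exists>t\<ge>T. 0 \<le> t \<and> (\<forall>w\<in>N. dist (f t x) w \<ge> \<delta> / 2)" for T
  proof -
    obtain t where t: "t \<ge> T" "t \<ge> 0" "dist (f t x) z < \<delta> / 2"
      using near[OF z(1), of "\<delta> / 2" T] d(1) by auto
    have "dist (f t x) w \<ge> \<delta> / 2" if "w \<in> N" for w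
    proof -
      have "dist z w \<ge> \<delta>" using d(2) that by (meson ComplD mem_ball not_le subset_iff)
      then show ?thesis using t(3) dist_triangle3[of z w "f t x"] by simp
    qed
    with t show ?thesis by blast
  qed
  show ?thesis
    unfolding chaotic_def
  proof (intro exI[of _ y] conjI)
    show "Liminf at_top (\<lambda>t. ereal (dist (f t x) y)) = 0"
    proof (rule Liminf_ereal_eq_0I)
      fix \<epsilon> T :: real assume "\<epsilon> > 0"
      then show "\<exists>t\<ge>T. dist (f t x) y < \<epsilon>"
        using near[OF yC] by blast
    qed simp
    show "Liminf at_top (\<lambda>t. ereal (dist (f t x) (f t y))) = 0"
      by (rule Liminf_ereal_eq_0I[OF zero_le_dist proximal_at_large_times[OF f C x yC y(2)]])
    show "Limsup at_top (\<lambda>t. ereal (dist (f t x) y)) > 0"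
    proof (rule Limsup_ereal_gt_0I[of "\<delta> / 2"])
      show "\<exists>t\<ge>T. \<delta> / 2 \<le> dist (f t x) y" for T
        using far y(1) by blast
    qed (use d(1) in simp)
    show "Limsup at_top (\<lambda>t. ereal (dist (f t x) (f t y))) > 0"
    proof (rule Limsup_ereal_gt_0I[of "\<delta> / 2"])
      fix T
      obtain t where "t \<ge> T" "t \<ge> 0" "\<forall>w\<in>N. dist (f t x) w \<ge> \<delta> / 2" using far by blast
      moreover from this have "f t y \<in> N" using N(3) y(1) by (simp add: invariant_def)
      ultimately show "\<exists>t\<ge>T. \<delta> / 2 \<le> dist (f t x) (f t y)" by blast
    qed (use d(1) in simp)
  qed
qed

section \<open>The residual set of transitive points\<close>

theorem theorem1p7:
  fixes f :: "real \<Rightarrow> 'a::polish_space \<Rightarrow> 'a" and p :: 'a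
  assumes "semiflow f"
    and "lagrange_stable f p"
    and "generic f (minimal_center f p)"
    and "\<not> minimal_subset f (minimal_center f p)"
  shows "\<exists>S. residual_in (top_of_set (minimal_center f p)) S \<and> (\<forall>x\<in>S. chaotic f x)"
proof -
  note f = assms(1)
  define C where "C = minimal_center f p"
  have Cp: "is_minimal_center f p C"
    unfolding C_def by (rule is_minimal_center_minimal_center[OF f assms(2)])
  then have "closed C" by (simp add: is_minimal_center_def center_of_attraction_def)
  have "C \<subseteq> closure (orbit f p)"
    using minimal_center_subset_closure_tail[OF f assms(2) Cp, of 0] by (simp add: orbit_def)
  moreover have "compact (closure (orbit f p))"
    using assms(2) by (simp add: lagrange_stable_def)
  ultimately have "compact C"
    using compact_Int_closed[OF _ \<open>closed C\<close>] by (metis Int_absorb1)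
  obtain q where inv: "invariant f C" and q: "q \<in> C" "is_minimal_center f q C"
    using assms(3) by (auto simp: generic_def C_def)
  have orbit_q: "orbit f q \<subseteq> C" using inv q(1) by (auto simp: invariant_def orbit_def)
  have "closure (orbit f q) \<subseteq> C" by (rule closure_minimal[OF orbit_q \<open>closed C\<close>])
  then have "lagrange_stable f q"
    unfolding lagrange_stable_def
    using compact_Int_closed[OF \<open>compact C\<close> closed_closure] by (metis Int_absorb1)
  note visits_q = minimal_center_visits[OF f this q(2)]
  \<comment> \<open>As \<open>C\<close> is closed, invariant and contains \<open>q\<close>, it can
    fail to be minimal only through a smaller such set.\<close>
  obtain N where N: "N \<subset> C" "N \<noteq> {}" "closed N" "invariant f N"
    using assms(4) q(1) \<open>closed C\<close> inv by (auto simp: minimal_subset_def C_def[symmetric])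
  obtain B :: "'a set set" where B: "countable B" "topological_basis B"
    using ex_countable_basis by blast
  \<comment> \<open>Basic open sets and integer times reduce late visits to all open sets to
    countably many open conditions.\<close>
  define V where "V U n = {x \<in> C. \<exists>t\<ge>real n. f t x \<in> U}" for U n
  define S where "S = C \<inter> (\<Inter>U\<in>{U \<in> B. U \<inter> C \<noteq> {}}. \<Inter>n. V U n)"
  have openV: "openin (top_of_set C) (V U n)" if "open U" for U n
  proof -
    have "V U n = C \<inter> (\<Union>t\<in>{real n..}. f t -` U)"
      by (auto simp: V_def)
    moreover have "open (f t -` U)" if "t \<in> {real n..}" for t
    proof (rule open_vimage[OF \<open>open U\<close>])
      show "continuous_on UNIV (f t)"
        using that by (intro semiflow_continuous_on[OF f]) (auto intro: order_trans[OF of_nat_0_le_iff])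
    qed
    ultimately show ?thesis by (simp add: openin_open_Int open_UN)
  qed
  have "gdelta_in (top_of_set C) S"
  proof -
    \<comment> \<open>Inserting \<open>C\<close> accounts for the outer factor of \<open>S\<close>
      and keeps the family nonempty.\<close>
    have "S = \<Inter>(insert C ((\<lambda>(U, n). V U n) ` ({U \<in> B. U \<inter> C \<noteq> {}} \<times> UNIV)))"
      by (auto simp: S_def)
    moreover have "gdelta_in (top_of_set C) \<dots>"
      using B openV topological_basis_open[OF B(2)] gdelta_in_topspace[of "top_of_set C"]
      by (intro gdelta_in_Inter) (auto intro!: countable_image open_imp_gdelta_in)
    ultimately show ?thesis by simp
  qed
  moreover have "orbit f q \<subseteq> S"
  proof -
    have "f s q \<in> V U n" if s: "s \<ge> 0" and U: "U \<in> B" "U \<inter> C \<noteq> {}" for s U n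
    proof -
      \<comment> \<open>A visit of \<open>q\<close> at time \<open>t\<close> is a visit of
        \<open>f s q\<close> at time \<open>t - s\<close>, so the bound is raised by
        \<open>s\<close> in advance.\<close>
      obtain t where t: "t \<ge> s + real n" "f t q \<in> U"
        using visits_q[of "s + real n" U] s U topological_basis_open[OF B(2)] by auto
      then have "f (t - s) (f s q) \<in> U" using f s by (simp add: semiflow_add)
      moreover have "t - s \<ge> real n" using t by simp
      moreover have "f s q \<in> C" using s orbit_q by (auto simp: orbit_def)
      ultimately show ?thesis unfolding V_def by blast
    qed
    then show ?thesis using orbit_q by (auto simp: S_def orbit_def)
  qed
  moreover have "C \<subseteq> closure (orbit f q)"
    using minimal_center_subset_closure_tail[OF f \<open>lagrange_stable f q\<close> q(2), of 0]
    by (simp add: orbit_def)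
  moreover have "S \<subseteq> C" by (simp add: S_def)
  \<comment> \<open>\<open>S\<close> is its own dense G-delta: it contains the orbit of
    \<open>q\<close>, whose closure contains \<open>C\<close>.\<close>
  ultimately have "residual_in (top_of_set C) S"
    unfolding residual_in_def using closure_mono[of "orbit f q" S]
    by (auto simp: closure_of_subtopology Int_absorb1 intro!: exI[of _ S])
  moreover have "chaotic f x" if x: "x \<in> S" for x
  proof (rule chaotic_if_transitive[OF f \<open>compact C\<close> inv _ _ N(2,3,4,1)])
    show "x \<in> C" using x by (simp add: S_def)
    fix U T assume U: "open U" "U \<inter> C \<noteq> {}"
    then obtain z where z: "z \<in> U" "z \<in> C" by blast
    obtain W where W: "W \<in> B" "z \<in> W" "W \<subseteq> U"
      using topological_basisE[OF B(2) U(1) z(1)] by metis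
    obtain n :: nat where n: "real n \<ge> T" using real_arch_simple by blast
    have "x \<in> V W n" using x W z by (auto simp: S_def)
    then obtain t where "t \<ge> real n" "f t x \<in> W" by (auto simp: V_def)
    moreover from this n have "t \<ge> T" "0 \<le> t" by (auto intro: order_trans[OF of_nat_0_le_iff])
    ultimately show "\<exists>t\<ge>T. 0 \<le> t \<and> f t x \<in> U" using W(3) by blast
  qed
  ultimately show ?thesis unfolding C_def by blast
qed

end
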